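(* Let $n\ge 2$ be an integer and let $G$ be a finite simple graph without odd components. If for every vertex $v\in V(G)$ the subgraph $G-v$ contains an $H_n$-factor, then $G$ contains an $H_n$-factor.
   Context: For an integer $n\ge 2$, an $H_n$-factor of a graph $G$ is a spanning subgraph $F$ of $G$ such that $d_F(v)\in\{1,3,5,\ldots,2n-1,2n\}$ for every vertex $v\in V(G)$, where $d_F(v)$ is the degree of $v$ in $F$. $G-v$ denotes the subgraph obtained from $G$ by removing the vertex $v$. An odd component is a connected component with an odd number of vertices. *)

theory Defs
  imports "Graph_Theory.Graph_Theory"
begin

text \<open>
  A finite simple graph is an instance of the locale \<^locale>\<open>graph\<close>: a finite symmetric
  digraph without loops and parallel arcs, each undirected edge being a pair of opposite arcs.
\<close>

text \<open>
  Each edge at a vertex contributes exactly one outgoing arc, so \<^const>\<open>out_degree\<close> is the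
  undirected degree.  The relation \<^const>\<open>spanning\<close> alone admits subdigraphs that contain only
  one of two opposite arcs; \<^prop>\<open>graph F\<close> excludes these.
\<close>
definition H_factor :: "nat \<Rightarrow> ('a, 'b) pre_digraph \<Rightarrow> ('a, 'b) pre_digraph \<Rightarrow> bool" where
  "H_factor n F G \<longleftrightarrow> graph F \<and> spanning F G \<and>
     (\<forall>v \<in> verts G. out_degree F v \<in> {d. odd d \<and> d \<le> 2 * n - 1} \<union> {2 * n})"

text \<open>
  Components are the maximal connected subgraphs.  In a symmetric digraph such a subdigraph
  contains, with each arc, also the opposite one.
\<close>
definition odd_component :: "('a, 'b) pre_digraph \<Rightarrow> ('a, 'b) pre_digraph \<Rightarrow> bool" where
  "odd_component C G \<longleftrightarrow> pre_digraph.max_subgraph G connected C \<and> odd (card (verts C))"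

end

theory Submission
  imports Defs
begin

text \<open>
  Suppose that \<open>G\<close> has no \<open>H\<^sub>n\<close>-factor, and call the numbers \<open>1, 3, \<dots>, 2n - 1, 2n\<close> admissible.
  The claim is that then every \<open>H\<^sub>n\<close>-factor \<open>F\<close> of \<open>G - v\<close> has only odd degrees.  By the handshake
  lemma \<open>|V(G)| - 1\<close> is then even, so \<open>G\<close> has odd order and therefore an odd component.

  The claim rests on the fact that the degree sequences of the subgraphs of \<open>G\<close> form a jump system
  of constant parity (lemma \<open>two_step\<close>): if \<open>x\<close> and \<open>y\<close> are degree sequences and \<open>x\<close> is moved one
  unit towards \<open>y\<close> in one coordinate, then a further unit step towards \<open>y\<close>, in a suitable
  coordinate, yields a degree sequence again.

  Now suppose that \<open>F\<close> has degree \<open>2n\<close> at a vertex \<open>u\<close>, and compare it with an \<open>H\<^sub>n\<close>-factor \<open>F'\<close> of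
  \<open>G - u\<close>, whose degree at \<open>u\<close> is \<open>0\<close>.  In \<open>F\<close> exactly one vertex has an inadmissible degree, namely
  \<open>v\<close>, and this degree is even and below \<open>2n\<close>.  Correcting it by one unit towards \<open>F'\<close> makes
  it admissible, and the second step can spoil the degree of at most one vertex.  Since only even
  numbers are missing below \<open>2n\<close>, the new subgraph has again exactly one inadmissible degree, even
  and below \<open>2n\<close>, or it is an \<open>H\<^sub>n\<close>-factor.  Iterating this approaches the degrees of \<open>F'\<close> forever
  unless an \<open>H\<^sub>n\<close>-factor appears.  The spoiled vertex is never \<open>u\<close>: the first step there leads from
  \<open>2n\<close> to the admissible \<open>2n - 1\<close>.  At every other vertex the degree in \<open>F'\<close> is admissible, so
  there is always room for the next step, and an \<open>H\<^sub>n\<close>-factor must appear (lemma \<open>descent\<close>).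
\<close>

section \<open>Degrees in edge sets\<close>

text \<open>
  The argument manipulates undirected edge sets, with edges as two-element sets.  Degrees are
  integers because they are compared by signed unit steps.
\<close>
definition edeg :: "'a set set \<Rightarrow> 'a \<Rightarrow> int" where
  "edeg F v = int (card {e \<in> F. v \<in> e})"

lemma edeg_nonneg: "0 \<le> edeg F v"
  by (simp add: edeg_def)

lemma edeg_eq_0: "(\<And>e. e \<in> F \<Longrightarrow> v \<notin> e) \<Longrightarrow> edeg F v = 0"
proof -
  assume "\<And>e. e \<in> F \<Longrightarrow> v \<notin> e"
  then have "{e \<in> F. v \<in> e} = {}" by auto
  then show ?thesis unfolding edeg_def by (simp only: card.empty of_nat_0)
qed

lemma edeg_insert:
  assumes "finite F" "e \<notin> F"
  shows "edeg (insert e F) v = edeg F v + of_bool (v \<in> e)"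
proof -
  have "{x \<in> insert e F. v \<in> x} = (if v \<in> e then insert e {x \<in> F. v \<in> x} else {x \<in> F. v \<in> x})"
    by auto
  with assms show ?thesis by (simp add: edeg_def)
qed

lemma edeg_remove:
  assumes "finite F" "e \<in> F"
  shows "edeg (F - {e}) v = edeg F v - of_bool (v \<in> e)"
  using edeg_insert[of "F - {e}" e v] assms by (simp add: insert_absorb)

lemma edeg_less_imp_edge:
  assumes "finite F" "edeg F v < edeg F' v"
  shows "\<exists>e \<in> F' - F. v \<in> e"
proof (rule ccontr)
  assume "\<not> ?thesis"
  then have "{e \<in> F'. v \<in> e} \<subseteq> {e \<in> F. v \<in> e}" by auto
  then have "edeg F' v \<le> edeg F v" using assms(1) by (simp add: edeg_def card_mono)
  with assms(2) show False by simp
qed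

lemma handshake:
  assumes "finite V" "finite F" "\<And>e. e \<in> F \<Longrightarrow> e \<subseteq> V \<and> card e = 2"
  shows "(\<Sum>v\<in>V. edeg F v) = 2 * int (card F)"
proof -
  have "(\<Sum>v\<in>V. card {e \<in> F. v \<in> e}) = 2 * card F"
  proof (rule sum_multicount[OF assms(1,2)])
    show "\<forall>e\<in>F. card {v \<in> V. v \<in> e} = 2"
    proof
      fix e assume "e \<in> F"
      then have "{v \<in> V. v \<in> e} = e" using assms(3) by auto
      with assms(3) \<open>e \<in> F\<close> show "card {v \<in> V. v \<in> e} = 2" by auto
    qed
  qed
  then show ?thesis
    unfolding edeg_def by (metis of_nat_sum of_nat_mult of_nat_numeral)
qed

section \<open>The two-step axiom\<close>

text \<open>
  If \<open>x p = y p\<close>, then \<open>toward y x p = x\<close>; a genuine step is one with \<open>x p \<noteq> y p\<close>.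
\<close>
definition toward :: "('a \<Rightarrow> int) \<Rightarrow> ('a \<Rightarrow> int) \<Rightarrow> 'a \<Rightarrow> 'a \<Rightarrow> int" where
  "toward y x p = x(p := x p + sgn (y p - x p))"

lemma toward_decreases_distance:
  assumes "finite V" "p \<in> V" "x p \<noteq> y p"
  shows "(\<Sum>v\<in>V. \<bar>toward y x p v - y v\<bar>) < (\<Sum>v\<in>V. \<bar>x v - y v\<bar>)"
proof (rule sum_strict_mono_ex1[OF assms(1)])
  show "\<forall>v\<in>V. \<bar>toward y x p v - y v\<bar> \<le> \<bar>x v - y v\<bar>"
    using assms(3) by (auto simp: toward_def sgn_if)
  show "\<exists>v\<in>V. \<bar>toward y x p v - y v\<bar> < \<bar>x v - y v\<bar>"
    using assms(2,3) by (intro bexI[of _ p]) (auto simp: toward_def sgn_if)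
qed

text \<open>
  Toggling an edge \<open>{p, q}\<close> of the symmetric difference of \<open>F\<close> and \<open>F'\<close> moves the degree at \<open>p\<close> in the
  desired direction, and that at \<open>q\<close> by the same sign.  If this is a step towards \<open>F'\<close> at \<open>q\<close> as
  well, it is the required second step.  If not, the new edge set needs a step at \<open>q\<close> in the
  opposite direction, which leads back to the degrees of \<open>F\<close> after the first step; so the
  induction hypothesis for the new edge set, which is closer to \<open>F'\<close>, gives the second step.
  Unfolded, the induction follows an alternating trail.
\<close>
lemma two_step:
  assumes "finite F" "finite F'" "\<And>e. e \<in> F \<union> F' \<Longrightarrow> card e = 2"
    and "edeg F p \<noteq> edeg F' p"
  shows "\<exists>K q. K \<subseteq> F \<union> F' \<and> toward (edeg F') (edeg F) p q \<noteq> edeg F' q \<and>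
    edeg K = toward (edeg F') (toward (edeg F') (edeg F) p) q"
  using assms
proof (induction "card ((F - F') \<union> (F' - F))" arbitrary: F p rule: less_induct)
  case less
  define y where "y = edeg F'"
  define \<sigma> where "\<sigma> = sgn (y p - edeg F p)"
  define x where "x = toward y (edeg F) p"
  \<comment> \<open>Both directions of the first step lead to the same situation, so signs are kept in \<open>\<sigma>\<close>.\<close>
  have "\<exists>F1 q. q \<noteq> p \<and> F1 \<subseteq> F \<union> F' \<and>
      (F1 - F') \<union> (F' - F1) \<subset> (F - F') \<union> (F' - F) \<and>
      edeg F1 = (edeg F)(p := edeg F p + \<sigma>, q := edeg F q + \<sigma>)"
  proof (cases "edeg F p < y p")
    case True
    then obtain e where e: "e \<in> F' - F" "p \<in> e"
      using edeg_less_imp_edge[OF less.prems(1), of p F'] by (auto simp: y_def)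
    then obtain q where "e = {p, q}" "q \<noteq> p"
      using less.prems(3)[of e] by (auto simp: card_2_iff doubleton_eq_iff)
    with e True show ?thesis
      by (intro exI[of _ "insert e F"] exI[of _ q])
         (auto simp: edeg_insert less.prems(1) \<sigma>_def fun_eq_iff)
  next
    case False
    then have "y p < edeg F p" using less.prems(4) by (simp add: y_def)
    then obtain e where e: "e \<in> F - F'" "p \<in> e"
      using edeg_less_imp_edge[OF less.prems(2), of p F] by (auto simp: y_def)
    then obtain q where "e = {p, q}" "q \<noteq> p"
      using less.prems(3)[of e] by (auto simp: card_2_iff doubleton_eq_iff)
    with e \<open>y p < edeg F p\<close> show ?thesis
      by (intro exI[of _ "F - {e}"] exI[of _ q])
         (auto simp: edeg_remove less.prems(1) \<sigma>_def fun_eq_iff)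
  qed
  then obtain F1 q where "q \<noteq> p" and F1: "F1 \<subseteq> F \<union> F'"
    and closer: "(F1 - F') \<union> (F' - F1) \<subset> (F - F') \<union> (F' - F)"
    and deg1: "edeg F1 = (edeg F)(p := edeg F p + \<sigma>, q := edeg F q + \<sigma>)" by blast
  have x: "x = (edeg F)(p := edeg F p + \<sigma>)" by (simp add: x_def toward_def \<sigma>_def)
  have \<sigma>: "\<sigma> = 1 \<or> \<sigma> = -1" using less.prems(4) by (auto simp: \<sigma>_def y_def sgn_if)
  have "\<exists>K r. K \<subseteq> F \<union> F' \<and> x r \<noteq> y r \<and> edeg K = toward y x r"
  proof (cases "sgn (y q - x q) = \<sigma>")
    case True
    have "edeg F1 = toward y x q" unfolding toward_def True using deg1 x \<open>q \<noteq> p\<close> by auto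
    moreover have "x q \<noteq> y q" using True \<sigma> by auto
    ultimately show ?thesis using F1 by blast
  next
    case False
    \<comment> \<open>The degree at \<open>q\<close> has overshot its target, and undoing this at \<open>q\<close>
      is a first step that leads to \<open>x\<close> again.\<close>
    have over: "sgn (y q - edeg F1 q) = - \<sigma>"
      using False \<sigma> deg1 x \<open>q \<noteq> p\<close> by (auto simp: sgn_if split: if_splits)
    then have returns: "toward y (edeg F1) q = x"
      unfolding toward_def over using deg1 x \<open>q \<noteq> p\<close> by auto
    have fin: "finite F1" using F1 less.prems(1,2) finite_subset by auto
    have "card ((F1 - F') \<union> (F' - F1)) < card ((F - F') \<union> (F' - F))"
      by (rule psubset_card_mono[OF _ closer]) (use less.prems(1,2) in auto)
    moreover have "edeg F1 q \<noteq> edeg F' q" using over \<sigma> by (auto simp: y_def)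
    moreover have "\<And>e. e \<in> F1 \<union> F' \<Longrightarrow> card e = 2" using F1 less.prems(3) by blast
    ultimately obtain K r where "K \<subseteq> F1 \<union> F'" "x r \<noteq> y r" "edeg K = toward y x r"
      using less.hyps[of F1 q] fin less.prems(2) returns unfolding y_def[symmetric] by auto
    with F1 show ?thesis by blast
  qed
  then show ?case unfolding x_def y_def .
qed

section \<open>Factors missing one vertex\<close>

text \<open>
  For \<open>n = 0\<close> this leaves only the degree \<open>0\<close>, as does the corresponding set of natural numbers.
\<close>
definition H_degree :: "nat \<Rightarrow> int \<Rightarrow> bool" where
  "H_degree n d \<longleftrightarrow> odd d \<and> 0 < d \<and> d < 2 * int n \<or> d = 2 * int n"

lemma H_degree_of_nat:
  "H_degree n (int d) \<longleftrightarrow> d \<in> {d. odd d \<and> d \<le> 2 * n - 1} \<union> {2 * n}"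
proof -
  have "odd d \<Longrightarrow> d \<le> 2 * n - 1 \<longleftrightarrow> d < 2 * n" using odd_pos[of d] by auto
  moreover have "odd d \<Longrightarrow> 0 < d" by (rule odd_pos)
  ultimately show ?thesis by (auto simp: H_degree_def)
qed

text \<open>
  Here \<open>p\<close> is the one vertex at which \<open>F\<close> has an inadmissible degree.  Two steps towards \<open>F'\<close>, the
  first of them at \<open>p\<close>, produce an edge set with the same properties that is strictly closer to
  \<open>F'\<close> in the \<open>\<ell>\<^sub>1\<close>-distance of degrees.  The degree \<open>2n\<close> at \<open>u\<close> is what keeps the process alive: \<open>u\<close> is
  the only vertex at which the degree in \<open>F'\<close> is inadmissible, and it never becomes the vertex to be
  corrected.
\<close>
lemma descent:
  assumes "finite V" "finite E" and E: "\<And>e. e \<in> E \<Longrightarrow> e \<subseteq> V \<and> card e = 2"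
    and no_factor: "\<not> (\<exists>K \<subseteq> E. \<forall>v \<in> V. H_degree n (edeg K v))"
    and F': "F' \<subseteq> E" "edeg F' u = 0" "\<And>v. v \<in> V - {u} \<Longrightarrow> H_degree n (edeg F' v)"
    and "F \<subseteq> E" "p \<in> V" "edeg F u = 2 * int n"
    and "even (edeg F p)" "edeg F p < 2 * int n"
    and "\<And>v. v \<in> V - {p} \<Longrightarrow> H_degree n (edeg F v)"
  shows False
  using assms(8-)
proof (induction "nat (\<Sum>v\<in>V. \<bar>edeg F v - edeg F' v\<bar>)" arbitrary: F p rule: less_induct)
  case less
  define x where "x = edeg F"
  define y where "y = edeg F'"
  define x1 where "x1 = toward y x p"
  have "p \<noteq> u" using less.prems(3,5) by auto
  then have yp: "H_degree n (y p)" using F'(3) less.prems(2) y_def by auto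
  have xp: "even (x p)" "x p < 2 * int n" "0 \<le> x p"
    using less.prems by (auto simp: x_def edeg_nonneg)
  then have "x p \<noteq> y p" using yp by (auto simp: H_degree_def)
  \<comment> \<open>An odd number results, and it is positive because \<open>y p > 0\<close> forces a step up from \<open>0\<close>.\<close>
  have x1p: "H_degree n (x1 p)"
  proof -
    have "odd (x p + sgn (y p - x p))" using xp \<open>x p \<noteq> y p\<close> by (auto simp: sgn_if)
    moreover have "x p = 0 \<Longrightarrow> y p > x p" using yp xp by (auto simp: H_degree_def)
    moreover have "x p \<le> 2 * int n - 2" "x p = 0 \<or> 2 \<le> x p" using xp by presburger+
    ultimately show ?thesis using xp
      by (auto simp: x1_def toward_def H_degree_def sgn_if split: if_splits)
  qed
  have "\<And>e. e \<in> F \<union> F' \<Longrightarrow> card e = 2" "finite F" "finite F'"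
    using E less.prems(1) F'(1) \<open>finite E\<close> finite_subset by blast+
  then obtain K q where "K \<subseteq> F \<union> F'" and q: "x1 q \<noteq> y q" and K: "edeg K = toward y x1 q"
    using two_step[of F F' p] \<open>x p \<noteq> y p\<close> unfolding x1_def x_def y_def by blast
  then have "K \<subseteq> E" using less.prems(1) F'(1) by blast
  have "q \<in> V"
  proof (rule ccontr)
    assume "q \<notin> V"
    then have "x q = 0" "y q = 0"
      unfolding x_def y_def using E less.prems(1) F'(1) by (blast intro: edeg_eq_0)+
    moreover have "q \<noteq> p" using \<open>q \<notin> V\<close> less.prems(2) by blast
    ultimately show False using q by (simp add: x1_def toward_def)
  qed
  have others: "H_degree n (edeg K v)" if "v \<in> V - {q}" for v
    using that K x1p less.prems(6) by (auto simp: toward_def x1_def x_def)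
  have bad: "\<not> H_degree n (edeg K q)"
    using no_factor \<open>K \<subseteq> E\<close> others by blast
  have "q \<noteq> u"
  proof
    assume "q = u"
    then have "edeg K q = 2 * int n - 1"
      using K less.prems(3) F'(2) \<open>p \<noteq> u\<close> xp
      by (auto simp: toward_def x1_def x_def y_def sgn_if)
    with bad xp show False by (auto simp: H_degree_def)
  qed
  \<comment> \<open>The degree at \<open>q\<close> before the last step is admissible.  From an odd degree a step leads to an
    even number of at most \<open>2n\<close>, and from \<open>2n\<close> it leads down to the admissible \<open>2n - 1\<close>.\<close>
  have "even (edeg K q) \<and> edeg K q < 2 * int n"
  proof (cases "q = p")
    case True
    then have "edeg K q = x1 p + sgn (y p - x1 p)" using K by (simp add: toward_def)
    moreover have "odd (x1 p)" "x1 p < 2 * int n"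
      using xp \<open>x p \<noteq> y p\<close> x1p by (auto simp: x1_def toward_def sgn_if H_degree_def)
    ultimately show ?thesis using bad q True by (auto simp: sgn_if H_degree_def)
  next
    case False
    then have "x1 q = x q" by (simp add: x1_def toward_def)
    then have "edeg K q = x q + sgn (y q - x q)" "x q \<noteq> y q" using K q by (auto simp: toward_def)
    moreover have "H_degree n (x q)" using less.prems(6) \<open>q \<in> V\<close> False x_def by auto
    moreover have "H_degree n (y q)" using F'(3) \<open>q \<in> V\<close> \<open>q \<noteq> u\<close> y_def by auto
    ultimately show ?thesis using bad xp by (auto simp: sgn_if H_degree_def split: if_splits)
  qed
  moreover have "edeg K u = 2 * int n"
    using K \<open>q \<noteq> u\<close> \<open>p \<noteq> u\<close> less.prems(3) by (auto simp: toward_def x1_def x_def)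
  moreover have "nat (\<Sum>v\<in>V. \<bar>edeg K v - y v\<bar>) < nat (\<Sum>v\<in>V. \<bar>x v - y v\<bar>)"
  proof -
    have "(\<Sum>v\<in>V. \<bar>edeg K v - y v\<bar>) < (\<Sum>v\<in>V. \<bar>x1 v - y v\<bar>)"
      unfolding K using toward_decreases_distance \<open>finite V\<close> \<open>q \<in> V\<close> q by metis
    also have "\<dots> < (\<Sum>v\<in>V. \<bar>x v - y v\<bar>)"
      unfolding x1_def using toward_decreases_distance \<open>finite V\<close> \<open>p \<in> V\<close> \<open>x p \<noteq> y p\<close> by metis
    finally have *: "(\<Sum>v\<in>V. \<bar>edeg K v - y v\<bar>) < (\<Sum>v\<in>V. \<bar>x v - y v\<bar>)" .
    have "0 \<le> (\<Sum>v\<in>V. \<bar>edeg K v - y v\<bar>)" by (simp add: sum_nonneg)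
    with * show ?thesis by (simp only: nat_less_eq_zless)
  qed
  ultimately show False
    using less.hyps[of K q] \<open>K \<subseteq> E\<close> \<open>q \<in> V\<close> others unfolding x_def y_def by blast
qed

text \<open>
  By the descent, the even value \<open>2n\<close> does not occur in a factor that misses \<open>v\<close>, so all degrees
  except that of \<open>v\<close> are odd and the handshake lemma decides the parity of \<open>V\<close>.
\<close>
lemma odd_card_if_vertex_deleted_factors:
  assumes "finite V" "finite E" and E: "\<And>e. e \<in> E \<Longrightarrow> e \<subseteq> V \<and> card e = 2"
    and no_factor: "\<not> (\<exists>K \<subseteq> E. \<forall>v \<in> V. H_degree n (edeg K v))"
    and deleted: "\<And>v. v \<in> V \<Longrightarrow>
      \<exists>F \<subseteq> E. edeg F v = 0 \<and> (\<forall>w \<in> V - {v}. H_degree n (edeg F w))"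
  shows "odd (card V)"
proof -
  obtain v where "v \<in> V" using no_factor by blast
  obtain F where F: "F \<subseteq> E" "edeg F v = 0" "\<And>w. w \<in> V - {v} \<Longrightarrow> H_degree n (edeg F w)"
    using deleted[OF \<open>v \<in> V\<close>] by blast
  have "n \<noteq> 0"
  proof
    assume "n = 0"
    then have "H_degree n (edeg F w)" if "w \<in> V" for w
      using F(2,3) that by (cases "w = v") (auto simp: H_degree_def)
    with no_factor F(1) show False by blast
  qed
  have odd_deg: "odd (edeg F u)" if u: "u \<in> V - {v}" for u
  proof
    assume "even (edeg F u)"
    then have "edeg F u = 2 * int n" using F(3)[OF u] by (auto simp: H_degree_def)
    moreover obtain F' where "F' \<subseteq> E" "edeg F' u = 0" "\<forall>w \<in> V - {u}. H_degree n (edeg F' w)"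
      using deleted[of u] u by blast
    ultimately show False
      using descent[OF assms(1-4), of F' u F v] F \<open>v \<in> V\<close> \<open>n \<noteq> 0\<close> by auto
  qed
  have "(\<Sum>w\<in>V. edeg F w) = 2 * int (card F)"
    using handshake[of V F] assms(1,2) E F(1) finite_subset by blast
  moreover have "(\<Sum>w\<in>V. edeg F w) = (\<Sum>w\<in>V - {v}. edeg F w)"
    using sum.remove[OF \<open>finite V\<close> \<open>v \<in> V\<close>, of "edeg F"] F(2) by simp
  moreover have "even (\<Sum>w\<in>V - {v}. edeg F w) \<longleftrightarrow> even (card (V - {v}))"
  proof -
    have "{w \<in> V - {v}. odd (edeg F w)} = V - {v}" using odd_deg by auto
    then show ?thesis using even_sum_iff[of "V - {v}" "edeg F"] \<open>finite V\<close> by simp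
  qed
  ultimately have "even (card (V - {v}))" by simp
  then show ?thesis using card_Suc_Diff1[OF \<open>finite V\<close> \<open>v \<in> V\<close>] by (metis even_Suc)
qed

section \<open>Graphs as symmetric digraphs\<close>

definition edges :: "('a, 'b) pre_digraph \<Rightarrow> 'a set set" where
  "edges G = (\<lambda>a. {tail G a, head G a}) ` arcs G"

definition edge_subgraph :: "('a, 'b) pre_digraph \<Rightarrow> 'a set set \<Rightarrow> ('a, 'b) pre_digraph" where
  "edge_subgraph G K = G\<lparr>arcs := {a \<in> arcs G. {tail G a, head G a} \<in> K}\<rparr>"

context graph
begin

lemma edges_props: "e \<in> edges G \<Longrightarrow> e \<subseteq> verts G \<and> card e = 2"
  using no_loops by (auto simp: edges_def card_2_iff)

text \<open>
  The edges at \<open>v\<close> correspond to the arcs leaving \<open>v\<close>: by symmetry each edge at \<open>v\<close> is given by such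
  an arc, and without parallel arcs by only one.
\<close>
lemma edeg_edges: "edeg (edges G) v = int (out_degree G v)"
proof -
  have "bij_betw (\<lambda>a. {tail G a, head G a}) (out_arcs G v) {e \<in> edges G. v \<in> e}"
  proof (rule bij_betw_imageI)
    show "inj_on (\<lambda>a. {tail G a, head G a}) (out_arcs G v)"
      by (rule inj_onI) (auto simp: doubleton_eq_iff arc_to_ends_def intro: no_multi_arcs)
    show "(\<lambda>a. {tail G a, head G a}) ` out_arcs G v = {e \<in> edges G. v \<in> e}"
    proof (intro equalityI subsetI)
      fix e assume "e \<in> {e \<in> edges G. v \<in> e}"
      then obtain a where a: "a \<in> arcs G" "e = {tail G a, head G a}" "v \<in> e"
        by (auto simp: edges_def)
      obtain b where b: "b \<in> arcs G" "tail G a = head G b" "head G a = tail G b"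
        using sym_arcs a(1) unfolding symmetric_conv by blast
      show "e \<in> (\<lambda>a. {tail G a, head G a}) ` out_arcs G v"
      proof (cases "v = tail G a")
        case True
        with a show ?thesis by auto
      next
        case False
        with a b show ?thesis by (intro image_eqI[of _ _ b]) auto
      qed
    qed (auto simp: edges_def)
  qed
  then show ?thesis by (simp add: edeg_def out_degree_def bij_betw_same_card)
qed

lemma graph_edge_subgraph: "graph (edge_subgraph G K)"
proof unfold_locales
  show "symmetric (edge_subgraph G K)"
    unfolding symmetric_conv
  proof
    fix a assume "a \<in> arcs (edge_subgraph G K)"
    then have a: "a \<in> arcs G" "{tail G a, head G a} \<in> K" by (auto simp: edge_subgraph_def)
    obtain b where "b \<in> arcs G" "tail G a = head G b" "head G a = tail G b"
      using sym_arcs a(1) unfolding symmetric_conv by blast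
    with a(2) show "\<exists>b\<in>arcs (edge_subgraph G K).
        tail (edge_subgraph G K) a = head (edge_subgraph G K) b \<and>
        head (edge_subgraph G K) a = tail (edge_subgraph G K) b"
      by (intro bexI[of _ b]) (auto simp: edge_subgraph_def insert_commute)
  qed
qed (auto simp: edge_subgraph_def arc_to_ends_def dest: no_loops intro: no_multi_arcs)

lemma spanning_edge_subgraph: "spanning (edge_subgraph G K) G"
  using graph_edge_subgraph[of K] wf_digraph
  by (auto simp: spanning_def subgraph_def edge_subgraph_def compatible_def graph_def digraph_def
      fin_digraph_def)

lemma edges_edge_subgraph:
  assumes "K \<subseteq> edges G"
  shows "edges (edge_subgraph G K) = K"
  using assms by (auto simp: edges_def edge_subgraph_def)

lemma H_factor_edge_subgraph:
  assumes "K \<subseteq> edges G" "\<forall>v \<in> verts G. H_degree n (edeg K v)"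
  shows "H_factor n (edge_subgraph G K) G"
proof -
  interpret K: graph "edge_subgraph G K" by (rule graph_edge_subgraph)
  show ?thesis
    using assms spanning_edge_subgraph[of K] K.graph_axioms K.edeg_edges
    by (simp add: H_factor_def edges_edge_subgraph H_degree_of_nat)
qed

lemma edges_of_vertex_deleted_H_factor:
  assumes "H_factor n F (del_vert v)"
  shows "edges F \<subseteq> edges G" "edeg (edges F) v = 0"
    "\<forall>w \<in> verts G - {v}. H_degree n (edeg (edges F) w)"
proof -
  have span: "spanning F (del_vert v)" using assms by (simp add: H_factor_def)
  interpret F: graph F using assms by (simp add: H_factor_def)
  show "edges F \<subseteq> edges G"
    using span by (auto simp: edges_def spanning_def subgraph_def compatible_def del_vert_def)
  have "v \<notin> verts F" using span by (auto simp: spanning_def del_vert_def)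
  then show "edeg (edges F) v = 0" using F.edges_props by (blast intro: edeg_eq_0)
  show "\<forall>w \<in> verts G - {v}. H_degree n (edeg (edges F) w)"
    using assms by (simp add: H_factor_def F.edeg_edges H_degree_of_nat del_vert_def)
qed

text \<open>
  Strong components are described in terms of reachability, which makes them a partition of the
  vertex set.  In a symmetric digraph they are also the maximal connected subgraphs.
\<close>
lemma max_connected_if_scc:
  assumes "C \<in> sccs"
  shows "max_subgraph connected C"
proof (rule max_subgraphI)
  have C: "max_subgraph strongly_connected C" using assms sccs_altdef2 by blast
  then show "subgraph C G" by (rule subgraphI_max_subgraph)
  then interpret C: wf_digraph C by (auto simp: subgraph_def)
  show "connected C"
    using max_subgraph_prop[OF C] C.reachable_mk_symmetricI
    by (simp add: connected_def strongly_connected_def)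
  fix Y assume Y: "C \<noteq> Y" "subgraph C Y" "subgraph Y G"
  show "\<not> connected Y"
  proof
    assume "connected Y"
    \<comment> \<open>\<open>Y\<close> may contain an arc without its opposite, so strong connectedness is only available
      for the subgraph induced by its vertices.\<close>
    let ?Z = "G \<restriction> verts Y"
    interpret Z: wf_digraph ?Z by (rule wellformed_induce_subgraph)
    have YZ: "subgraph Y ?Z" using Y(3) by (rule subgraph_induce_subgraphI2)
    have ind: "induced_subgraph ?Z G" using Y(3) by (intro induced_induce) (auto simp: subgraph_def)
    have "connected ?Z"
      using Z.connected_spanning_imp_connected[of Y] YZ \<open>connected Y\<close> by (simp add: spanning_def)
    then have "strongly_connected ?Z"
      using Z.symmetric_connected_imp_strongly_connected
        induced_graph_imp_symmetric[OF sym_arcs ind] by blast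
    moreover have CZ: "subgraph C ?Z" using Y(2) YZ by (rule subgraph_trans)
    ultimately have "C = ?Z"
      using C induced_imp_subgraph[OF ind] unfolding max_subgraph_def by metis
    with Y YZ show False by (auto simp: subgraph_def compatible_def)
  qed
qed

lemma odd_component_if_odd_order:
  assumes "odd (card (verts G))"
  shows "\<exists>C. odd_component C G"
proof (rule ccontr)
  assume none: "\<not> ?thesis"
  have "even (card S)" if "S \<in> sccs_verts" for S
    using none max_connected_if_scc[OF in_verts_sccsD_sccs[OF that]]
    by (auto simp: odd_component_def)
  then have "even (\<Sum>S\<in>sccs_verts. card S)" by (rule dvd_sum)
  moreover have "\<Union> sccs_verts = verts G"
    using in_scc_of_self scc_of_in_sccs_verts sccs_verts_subsets by blast
  moreover have "card (\<Union> sccs_verts) = (\<Sum>S\<in>sccs_verts. card S)"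
  proof (rule card_Union_disjoint)
    show "pairwise disjnt sccs_verts"
      using sccs_verts_disjoint by (auto simp: pairwise_def disjnt_def)
    show "\<And>S. S \<in> sccs_verts \<Longrightarrow> finite S"
      using sccs_verts_subsets finite_verts finite_subset by metis
  qed
  ultimately show False using assms by simp
qed

end

theorem theorem3p5:
  fixes G :: "('a, 'b) pre_digraph" and n :: nat
  assumes "n \<ge> 2"
    and "graph G"
    and "\<not> (\<exists>C. odd_component C G)"
    and "\<And>v. v \<in> verts G \<Longrightarrow> \<exists>F. H_factor n F (pre_digraph.del_vert G v)"
  shows "\<exists>F. H_factor n F G"
proof (rule ccontr)
  assume none: "\<not> ?thesis"
  interpret graph G by fact
  have "finite (edges G)" by (simp add: edges_def)
  moreover have "\<not> (\<exists>K \<subseteq> edges G. \<forall>v \<in> verts G. H_degree n (edeg K v))"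
    using none H_factor_edge_subgraph by blast
  moreover have "\<exists>F \<subseteq> edges G. edeg F v = 0 \<and> (\<forall>w \<in> verts G - {v}. H_degree n (edeg F w))"
    if v: "v \<in> verts G" for v
  proof -
    obtain F where F: "H_factor n F (del_vert v)" using assms(4)[OF v] ..
    from edges_of_vertex_deleted_H_factor[OF F] show ?thesis
      by (intro exI[of _ "edges F"] conjI)
  qed
  ultimately have "odd (card (verts G))"
    by (intro odd_card_if_vertex_deleted_factors[OF finite_verts _ edges_props])
  with assms(3) odd_component_if_odd_order show False by blast
qed

end
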